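(* Let $0<\alpha<1$, let $a<b$ be real numbers and let $\varphi,\psi\in\mathcal{S}(\mathbb{R})$ be real-valued Schwartz functions. (1) Suppose that $(D_{\rm right})^\alpha\varphi=f$ in $[a,b)$ and $\varphi=0$ in $[b,\infty)$. If $f\ge0$ in $[a,b)$, then $\varphi\ge0$ in $[a,\infty)$. (2) If $(D_{\rm right})^\alpha\varphi\le0$ in $[a,b)$ and $\varphi\le0$ in $[b,\infty)$, then $\sup_{x>a}\varphi(x)=\sup_{x>b}\varphi(x)$. (3) If $(D_{\rm right})^\alpha\varphi\ge0$ in $[a,b)$ and $\varphi\ge0$ in $[b,\infty)$, then $\inf_{x>a}\varphi(x)=\inf_{x>b}\varphi(x)$. (4) If $(D_{\rm right})^\alpha\varphi\ge(D_{\rm right})^\alpha\psi$ in $[a,b)$ and $\varphi\ge\psi$ in $[b,\infty)$, then $\varphi\ge\psi$ in $[a,\infty)$. In particular, solutions of the Dirichlet problem $$\begin{cases}(D_{\rm right})^\alpha\varphi=f,&\text{in }[a,b),\\ \varphi=g,&\text{in }[b,\infty),\end{cases}$$ are unique: if two real-valued functions in $\mathcal{S}(\mathbb{R})$ solve this problem with the same data $f:[a,b)\to\mathbb{R}$ and $g:[b,\infty)\to\mathbb{R}$, then they coincide on $[a,\infty)$.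
   Context: For $0<\alpha<1$ and $\varphi\in\mathcal{S}(\mathbb{R})$, the fractional derivative from the right is the absolutely convergent integral $$(D_{\rm right})^\alpha\varphi(x)=\frac{1}{\Gamma(-\alpha)}\int_x^\infty\frac{\varphi(t)-\varphi(x)}{(t-x)^{1+\alpha}}\,dt,\qquad x\in\mathbb{R}.$$ Here $\Gamma(-\alpha)=\Gamma(1-\alpha)/(-\alpha)<0$. *)

theory Defs
  imports "HOL-Analysis.Analysis"
begin

text \<open>Real-valued members of the Schwartz space on the real line. The first conjunct
  (every iterated derivative is differentiable everywhere) is smoothness; it also guarantees that
  the iterates of \<^const>\<open>deriv\<close> are genuine derivatives.\<close>

definition schwartz :: "(real \<Rightarrow> real) \<Rightarrow> bool" where
  "schwartz \<phi> \<longleftrightarrow>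
     (\<forall>n x. (deriv ^^ n) \<phi> differentiable (at x)) \<and>
     (\<forall>k n. \<exists>C. \<forall>x. \<bar>x\<bar> ^ k * \<bar>(deriv ^^ n) \<phi> x\<bar> \<le> C)"

lemma schwartz_bounded:
  assumes "schwartz \<phi>"
  shows "bounded (range \<phi>)"
proof -
  obtain C where "\<And>x. \<bar>x\<bar> ^ 0 * \<bar>(deriv ^^ 0) \<phi> x\<bar> \<le> C"
    using assms unfolding schwartz_def by blast
  then show ?thesis
    by (auto simp: bounded_iff)
qed

text \<open>The Lebesgue integral over the half-line converges absolutely for
  \<open>0 < \<alpha> < 1\<close> and Schwartz \<open>\<phi>\<close>: the integrand is \<open>O((t - x) powr -\<alpha>)\<close> as \<open>t\<close> tends to \<open>x\<close>
  and \<open>O((t - x) powr (-1 - \<alpha>))\<close> at infinity.\<close>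

definition D_right :: "real \<Rightarrow> (real \<Rightarrow> real) \<Rightarrow> real \<Rightarrow> real" where
  "D_right \<alpha> \<phi> x =
     1 / Gamma (-\<alpha>) * (LBINT t:{x<..}. (\<phi> t - \<phi> x) / (t - x) powr (1 + \<alpha>))"

text \<open>The data \<open>f\<close> and \<open>g\<close> are total functions, but only their restrictions to \<open>[a, b)\<close> and
  \<open>[b, \<infinity>)\<close> matter.\<close>

definition dirichlet_solution ::
  "real \<Rightarrow> real \<Rightarrow> real \<Rightarrow> (real \<Rightarrow> real) \<Rightarrow> (real \<Rightarrow> real) \<Rightarrow> (real \<Rightarrow> real) \<Rightarrow> bool" where
  "dirichlet_solution \<alpha> a b f g \<phi> \<longleftrightarrow>
     schwartz \<phi> \<and> (\<forall>x\<in>{a..<b}. D_right \<alpha> \<phi> x = f x) \<and> (\<forall>x\<in>{b..}. \<phi> x = g x)"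

end

theory Submission
  imports Defs
begin

text \<open>
  Since \<open>\<Gamma>(-\<alpha>) < 0\<close>, at a point \<open>x\<close> where \<open>\<phi>\<close> attains its minimum over \<open>[x, \<infinity>)\<close> the integrand
  of \<open>D_right\<close> is nonnegative, so \<open>D_right \<alpha> \<phi> x \<le> 0\<close>, with equality only if \<open>\<phi>\<close> is constant on
  \<open>[x, \<infinity>)\<close>. If \<open>\<phi> \<ge> 0\<close> on \<open>[b, \<infinity>)\<close> but \<open>\<phi>\<close> is negative somewhere on \<open>[a, b)\<close>, then its minimum
  over \<open>[a, b]\<close> is such a point with \<open>D_right \<alpha> \<phi> x \<ge> 0\<close>, so \<open>\<phi>\<close> is a negative constant
  on \<open>[x, \<infinity>)\<close>, contradicting \<open>\<phi> b \<ge> 0\<close>. Linearity gives the comparison principle. In the supremum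
  and infimum statements both sides are \<open>0\<close>, because Schwartz functions vanish at infinity.
\<close>

text \<open>The functional equation gives
  \<open>Gamma (1 - \<alpha>) = -\<alpha> * Gamma (-\<alpha>)\<close> with positive left side; it
  applies because -\<alpha> is not a pole.\<close>

lemma Gamma_neg_real:
  fixes \<alpha> :: real
  assumes "0 < \<alpha>" "\<alpha> < 1"
  shows "Gamma (-\<alpha>) < 0"
proof -
  have "-\<alpha> \<notin> \<int>\<^sub>\<le>\<^sub>0"
  proof
    assume "-\<alpha> \<in> \<int>\<^sub>\<le>\<^sub>0"
    then obtain n where "-\<alpha> = of_int n" and "n \<le> 0"
      by (auto simp: nonpos_Ints_def)
    then have "-1 < n" "n < 0"
      using assms by linarith+
    then show False
      by simp
  qed
  then have "Gamma (1 - \<alpha>) = -\<alpha> * Gamma (-\<alpha>)"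
    using Gamma_plus1[of "-\<alpha>"] by (simp add: add.commute)
  moreover have "Gamma (1 - \<alpha>) > 0"
    using assms by simp
  ultimately show ?thesis
    using assms by (simp add: mult_less_0_iff zero_less_mult_iff)
qed

text \<open>The Schwartz bound on the first derivative combined with the mean value inequality. The
  integral estimates and the minimum principle work with Lipschitz continuity and boundedness, which
  pass directly to differences.\<close>

lemma schwartz_lipschitz:
  assumes "schwartz \<phi>"
  obtains L where "L-lipschitz_on UNIV \<phi>"
proof -
  have "\<phi> differentiable (at x)" for x
    using assms unfolding schwartz_def by (metis funpow_0)
  then have deriv: "(\<phi> has_real_derivative deriv \<phi> x) (at x)" for x
    by (simp add: DERIV_deriv_iff_real_differentiable)
  obtain C where "\<And>x. \<bar>x\<bar> ^ 0 * \<bar>(deriv ^^ 1) \<phi> x\<bar> \<le> C"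
    using assms unfolding schwartz_def by blast
  then have C: "\<bar>deriv \<phi> x\<bar> \<le> C" for x
    by simp
  have "0 \<le> C"
    using C[of 0] by linarith
  moreover have "dist (\<phi> x) (\<phi> y) \<le> C * dist x y" for x y
    using field_differentiable_bound[of UNIV \<phi> "deriv \<phi>" C x y] deriv C
    by (simp add: dist_norm)
  ultimately have "C-lipschitz_on UNIV \<phi>"
    by (intro lipschitz_onI)
  then show ?thesis ..
qed

text \<open>The Schwartz bound with one power of x and no derivative makes C / x a majorant for
  positive x.\<close>

lemma schwartz_tendsto_0:
  assumes "schwartz \<phi>"
  shows "(\<phi> \<longlongrightarrow> 0) at_top"
proof -
  obtain C where "\<And>x. \<bar>x\<bar> ^ 1 * \<bar>(deriv ^^ 0) \<phi> x\<bar> \<le> C"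
    using assms unfolding schwartz_def by blast
  then have C: "\<bar>x\<bar> * \<bar>\<phi> x\<bar> \<le> C" for x
    by simp
  show ?thesis
  proof (rule Lim_null_comparison)
    show "\<forall>\<^sub>F x in at_top. norm (\<phi> x) \<le> C / x"
      using eventually_gt_at_top[of 0]
      by eventually_elim (metis C abs_of_pos mult.commute pos_le_divide_eq real_norm_def)
    show "((\<lambda>x. C / x) \<longlongrightarrow> 0) at_top"
      by (intro tendsto_divide_0[OF tendsto_const] filterlim_at_top_imp_at_infinity filterlim_ident)
  qed
qed

text \<open>Split at distance 1 from x. Nearby, the Lipschitz bound cancels one power and leaves a
  multiple of \<open>s powr (-\<alpha>)\<close>, integrable since \<alpha> < 1; farther out,
  boundedness leaves a multiple of \<open>s powr (-(1 + \<alpha>))\<close>, integrable since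
  \<alpha> > 0.\<close>

lemma set_integrable_fractional_difference:
  fixes \<phi> :: "real \<Rightarrow> real"
  assumes \<alpha>: "0 < \<alpha>" "\<alpha> < 1" and lip: "L-lipschitz_on UNIV \<phi>" and bdd: "bounded (range \<phi>)"
  shows "set_integrable lborel {x<..} (\<lambda>t. (\<phi> t - \<phi> x) / (t - x) powr (1 + \<alpha>))"
proof -
  \<comment> \<open>The shift t = x + s moves the singularity to 0.\<close>
  define h where "h s = (\<phi> (x + s) - \<phi> x) / s powr (1 + \<alpha>)" for s
  have [measurable]: "\<phi> \<in> borel_measurable borel"
    using lipschitz_on_continuous_on[OF lip] by (rule borel_measurable_continuous_onI)
  have h_meas [measurable]: "h \<in> borel_measurable borel"
    unfolding h_def by measurable
  obtain B where B: "\<bar>\<phi> y\<bar> \<le> B" for y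
    using bdd by (auto simp: bounded_iff)
  have near: "set_integrable lborel {0<..1} h"
  proof (rule set_integrable_bound)
    \<comment> \<open>The power is known to be gauge integrable; being nonnegative it is absolutely
      integrable for \<open>lebesgue\<close>, and its measurability brings this back to
      \<open>lborel\<close>.\<close>
    have "set_integrable lebesgue {0<..1} (\<lambda>s::real. s powr (-\<alpha>))"
      using \<alpha> by (intro nonnegative_absolutely_integrable_1 integrable_on_powr_from_0') auto
    then show "set_integrable lborel {0<..1} (\<lambda>s. L * s powr (-\<alpha>))"
      by (intro set_integrable_mult_right)
        (simp add: set_integrable_def integrable_completion)
    show "set_borel_measurable lborel {0<..1} h"
      unfolding set_borel_measurable_def by measurable
    have "\<bar>h s\<bar> \<le> L * s powr (-\<alpha>)" if "s > 0" for s
    proof -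
      have "\<bar>h s\<bar> = \<bar>\<phi> (x + s) - \<phi> x\<bar> / s powr (1 + \<alpha>)"
        by (simp add: h_def)
      also have "\<dots> \<le> L * s / s powr (1 + \<alpha>)"
        using lipschitz_onD[OF lip, of "x + s" x] that
        by (intro divide_right_mono) (auto simp: dist_norm)
      also have "\<dots> = L * s powr (-\<alpha>)"
        using that by (simp add: powr_add powr_minus field_simps)
      finally show ?thesis .
    qed
    then show "AE s in lborel. s \<in> {0<..1} \<longrightarrow> norm (h s) \<le> norm (L * s powr (-\<alpha>))"
      by (intro always_eventually allI impI) (simp add: order_trans[OF _ abs_ge_self] del: abs_mult)
  qed
  have far: "set_integrable lborel {1..} h"
  proof (rule set_integrable_bound)
    have "set_integrable lebesgue {1..} (\<lambda>s::real. s powr (-(1 + \<alpha>)))"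
      using \<alpha> has_integral_powr_to_inf[of "-(1 + \<alpha>)" 1]
      by (intro nonnegative_absolutely_integrable_1) (auto simp: integrable_on_def)
    then show "set_integrable lborel {1..} (\<lambda>s. 2 * B * s powr (-(1 + \<alpha>)))"
      by (intro set_integrable_mult_right)
        (simp add: set_integrable_def integrable_completion)
    show "set_borel_measurable lborel {1..} h"
      unfolding set_borel_measurable_def by measurable
    have "\<bar>h s\<bar> \<le> 2 * B * s powr (-(1 + \<alpha>))" for s
    proof -
      have "\<bar>\<phi> (x + s) - \<phi> x\<bar> \<le> 2 * B"
        using B[of "x + s"] B[of x] by linarith
      then show ?thesis
        unfolding h_def powr_minus by (simp add: divide_inverse abs_mult mult_right_mono)
    qed
    then show "AE s in lborel. s \<in> {1..} \<longrightarrow> norm (h s) \<le> norm (2 * B * s powr (-(1 + \<alpha>)))"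
      by (intro always_eventually allI impI) (simp add: order_trans[OF _ abs_ge_self] del: abs_mult)
  qed
  have "{0<..} = {0<..1} \<union> {1::real..}"
    by auto
  then have "set_integrable lborel {0<..} h"
    using set_integrable_Un[OF near far] by simp
  \<comment> \<open>Undo the shift: s = -x + 1 * t is an affine substitution with slope 1.\<close>
  then have "integrable lborel (\<lambda>t. indicator {0<..} (-x + 1 * t) *\<^sub>R h (-x + 1 * t))"
    unfolding set_integrable_def by (rule lborel_integrable_real_affine) simp
  also have "(\<lambda>t. indicator {0<..} (-x + 1 * t) *\<^sub>R h (-x + 1 * t)) =
      (\<lambda>t. indicator {x<..} t *\<^sub>R ((\<phi> t - \<phi> x) / (t - x) powr (1 + \<alpha>)))"
    by (auto simp: h_def indicator_def fun_eq_iff)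
  finally show ?thesis
    unfolding set_integrable_def .
qed

text \<open>A nonintegrable function has integral 0 by convention, so splitting the integral relies
  on both fractional differences being integrable.\<close>

lemma D_right_diff:
  assumes "0 < \<alpha>" "\<alpha> < 1"
    and "L-lipschitz_on UNIV \<phi>" "bounded (range \<phi>)"
    and "M-lipschitz_on UNIV \<psi>" "bounded (range \<psi>)"
  shows "D_right \<alpha> (\<lambda>y. \<phi> y - \<psi> y) x = D_right \<alpha> \<phi> x - D_right \<alpha> \<psi> x"
proof -
  have "(LBINT t:{x<..}. (\<phi> t - \<psi> t - (\<phi> x - \<psi> x)) / (t - x) powr (1 + \<alpha>)) =
      (LBINT t:{x<..}. (\<phi> t - \<phi> x) / (t - x) powr (1 + \<alpha>) - (\<psi> t - \<psi> x) / (t - x) powr (1 + \<alpha>))"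
    by (simp add: diff_divide_distrib[symmetric] algebra_simps)
  also have "\<dots> = (LBINT t:{x<..}. (\<phi> t - \<phi> x) / (t - x) powr (1 + \<alpha>)) -
      (LBINT t:{x<..}. (\<psi> t - \<psi> x) / (t - x) powr (1 + \<alpha>))"
    using assms by (intro set_integral_diff set_integrable_fractional_difference)
  finally show ?thesis
    by (simp add: D_right_def diff_divide_distrib)
qed

text \<open>The nonnegative integrand has integral \<le> 0 because the Gamma factor is negative, so
  it vanishes almost everywhere; continuity removes the exceptional null set.\<close>

lemma constant_if_D_right_nonneg_at_min:
  fixes \<phi> :: "real \<Rightarrow> real"
  assumes \<alpha>: "0 < \<alpha>" "\<alpha> < 1" and lip: "L-lipschitz_on UNIV \<phi>" and bdd: "bounded (range \<phi>)"
    and min: "\<And>t. x < t \<Longrightarrow> \<phi> x \<le> \<phi> t" and D: "D_right \<alpha> \<phi> x \<ge> 0" and "x < y"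
  shows "\<phi> y = \<phi> x"
proof -
  define k where "k t = indicator {x<..} t *\<^sub>R ((\<phi> t - \<phi> x) / (t - x) powr (1 + \<alpha>))" for t
  have k_int: "integrable lborel k"
    using set_integrable_fractional_difference[OF \<alpha> lip bdd, of x]
    unfolding set_integrable_def k_def .
  have k_nonneg: "0 \<le> k t" for t
    using min by (simp add: k_def indicator_def)
  have "D_right \<alpha> \<phi> x = (\<integral>t. k t \<partial>lborel) / Gamma (-\<alpha>)"
    by (simp add: D_right_def k_def set_lebesgue_integral_def)
  then have "(\<integral>t. k t \<partial>lborel) \<le> 0"
    using D Gamma_neg_real[OF \<alpha>] by (simp add: zero_le_divide_iff)
  then have "(\<integral>t. k t \<partial>lborel) = 0"
    using k_nonneg by (simp add: order_antisym)
  then have "AE t in lborel. k t = 0"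
    using k_int k_nonneg by (simp add: integral_nonneg_eq_0_iff_AE)
  then have "AE t in lborel. t \<in> {x<..} \<longrightarrow> t \<in> {t. \<phi> t = \<phi> x}"
    by eventually_elim (auto simp: k_def)
  then have ae: "AE t\<in>{x<..} in lebesgue. t \<in> {t. \<phi> t = \<phi> x}"
    by (rule AE_completion)
  \<comment> \<open>A closed set that contains almost every point of an open set contains all of it;
    this turns equality almost everywhere into equality at y.\<close>
  have "closed {t. \<phi> t = \<phi> x}"
    using lipschitz_on_continuous_on[OF lip] by (intro closed_Collect_eq) auto
  from mem_closed_if_AE_lebesgue_open[OF open_greaterThan this ae, of y] show ?thesis
    using \<open>x < y\<close> by simp
qed

lemma D_right_minimum_principle:
  fixes \<phi> :: "real \<Rightarrow> real"
  assumes \<alpha>: "0 < \<alpha>" "\<alpha> < 1" and lip: "L-lipschitz_on UNIV \<phi>" and bdd: "bounded (range \<phi>)"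
    and D: "\<And>x. x \<in> {a..<b} \<Longrightarrow> D_right \<alpha> \<phi> x \<ge> 0"
    and nonneg: "\<And>x. b \<le> x \<Longrightarrow> \<phi> x \<ge> 0" and "a \<le> x"
  shows "\<phi> x \<ge> 0"
proof (rule ccontr)
  assume neg: "\<not> \<phi> x \<ge> 0"
  then have "x < b"
    using nonneg linorder_not_less by blast
  have "continuous_on {a..b} \<phi>"
    using lipschitz_on_continuous_on[OF lip] continuous_on_subset by blast
  then obtain m where m: "m \<in> {a..b}" and m_min: "\<And>t. t \<in> {a..b} \<Longrightarrow> \<phi> m \<le> \<phi> t"
    using \<open>a \<le> x\<close> \<open>x < b\<close> continuous_attains_inf[of "{a..b}" \<phi>] by auto
  have "\<phi> m < 0"
    using m_min[of x] neg \<open>a \<le> x\<close> \<open>x < b\<close> by auto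
  \<comment> \<open>The minimum is not at b, so m lies in the half-open interval where
    \<open>D\<close> is available.\<close>
  then have "m < b"
    using nonneg[of m] by linarith
  have "\<phi> b = \<phi> m"
  proof (rule constant_if_D_right_nonneg_at_min[OF \<alpha> lip bdd])
    \<comment> \<open>Up to b this is the choice of m; beyond b, \<phi> is nonnegative while \<phi>
      m is negative.\<close>
    show "\<phi> m \<le> \<phi> t" if "m < t" for t
      using that m m_min[of t] nonneg[of t] \<open>\<phi> m < 0\<close> by (cases "t \<le> b") auto
    show "D_right \<alpha> \<phi> m \<ge> 0"
      using m \<open>m < b\<close> by (intro D) simp
  qed (fact \<open>m < b\<close>)
  then show False
    using nonneg[of b] \<open>\<phi> m < 0\<close> by simp
qed

lemma D_right_comparison:
  fixes \<phi> \<psi> :: "real \<Rightarrow> real"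
  assumes \<alpha>: "0 < \<alpha>" "\<alpha> < 1" and "schwartz \<phi>" "schwartz \<psi>"
    and D: "\<And>x. x \<in> {a..<b} \<Longrightarrow> D_right \<alpha> \<psi> x \<le> D_right \<alpha> \<phi> x"
    and le: "\<And>x. b \<le> x \<Longrightarrow> \<psi> x \<le> \<phi> x" and "a \<le> x"
  shows "\<psi> x \<le> \<phi> x"
proof -
  obtain L M where lip: "L-lipschitz_on UNIV \<phi>" "M-lipschitz_on UNIV \<psi>"
    using assms schwartz_lipschitz by metis
  have bdd: "bounded (range \<phi>)" "bounded (range \<psi>)"
    using assms schwartz_bounded by auto
  have "0 \<le> \<phi> x - \<psi> x"
  proof (rule D_right_minimum_principle[OF \<alpha>, where \<phi> = "\<lambda>y. \<phi> y - \<psi> y" and x = x])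
    show "(L + M)-lipschitz_on UNIV (\<lambda>y. \<phi> y - \<psi> y)"
      using lip by (rule lipschitz_on_diff)
    show "bounded (range (\<lambda>y. \<phi> y - \<psi> y))"
      using bdd by (rule bounded_minus_comp)
    show "0 \<le> D_right \<alpha> (\<lambda>y. \<phi> y - \<psi> y) y" if "y \<in> {a..<b}" for y
      using D[OF that] lip bdd by (simp add: D_right_diff[OF \<alpha> lip(1) bdd(1) lip(2) bdd(2)])
  qed (use le \<open>a \<le> x\<close> in auto)
  then show ?thesis
    by simp
qed

text \<open>Comparison with the zero function yields the sign statements.\<close>

lemma schwartz_0: "schwartz (\<lambda>_. 0)"
proof -
  have "(deriv ^^ n) (\<lambda>_::real. 0::real) = (\<lambda>_. 0)" for n
    by (induction n) auto
  then show ?thesis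
    by (auto simp: schwartz_def)
qed

lemma D_right_0: "D_right \<alpha> (\<lambda>_. 0) x = 0"
  by (simp add: D_right_def set_lebesgue_integral_def)

text \<open>Zero bounds the values from above, and any upper bound on a half-line also bounds the
  limit 0. The value does not depend on c, so two half-lines can be compared through it.\<close>

lemma cSUP_eq_0_if_tendsto_0:
  fixes \<phi> :: "real \<Rightarrow> real"
  assumes lim: "(\<phi> \<longlongrightarrow> 0) at_top" and "\<And>x. c < x \<Longrightarrow> \<phi> x \<le> 0"
  shows "(SUP x\<in>{c<..}. \<phi> x) = 0"
proof (rule antisym)
  have bdd: "bdd_above (\<phi> ` {c<..})"
    using assms(2) by (intro bdd_aboveI2[where M = 0]) auto
  show "(SUP x\<in>{c<..}. \<phi> x) \<le> 0"
    using assms(2) by (intro cSUP_least) auto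
  show "0 \<le> (SUP x\<in>{c<..}. \<phi> x)"
    by (rule tendsto_upperbound[OF lim])
      (auto intro!: eventually_mono[OF eventually_gt_at_top[of c]] cSUP_upper bdd)
qed

lemma cINF_eq_0_if_tendsto_0:
  fixes \<phi> :: "real \<Rightarrow> real"
  assumes lim: "(\<phi> \<longlongrightarrow> 0) at_top" and "\<And>x. c < x \<Longrightarrow> 0 \<le> \<phi> x"
  shows "(INF x\<in>{c<..}. \<phi> x) = 0"
proof (rule antisym)
  have bdd: "bdd_below (\<phi> ` {c<..})"
    using assms(2) by (intro bdd_belowI2[where m = 0]) auto
  show "0 \<le> (INF x\<in>{c<..}. \<phi> x)"
    using assms(2) by (intro cINF_greatest) auto
  show "(INF x\<in>{c<..}. \<phi> x) \<le> 0"
    by (rule tendsto_lowerbound[OF lim])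
      (auto intro!: eventually_mono[OF eventually_gt_at_top[of c]] cINF_lower bdd)
qed

theorem corollary1p2:
  fixes \<alpha> a b :: real and \<phi> \<psi> :: "real \<Rightarrow> real"
  assumes "0 < \<alpha>" and "\<alpha> < 1" and "a < b" and "schwartz \<phi>" and "schwartz \<psi>"
  shows
    "(\<forall>f :: real \<Rightarrow> real.
        (\<forall>x\<in>{a..<b}. D_right \<alpha> \<phi> x = f x) \<longrightarrow> (\<forall>x\<in>{b..}. \<phi> x = 0) \<longrightarrow>
        (\<forall>x\<in>{a..<b}. f x \<ge> 0) \<longrightarrow> (\<forall>x\<in>{a..}. \<phi> x \<ge> 0)) \<and>
     ((\<forall>x\<in>{a..<b}. D_right \<alpha> \<phi> x \<le> 0) \<longrightarrow> (\<forall>x\<in>{b..}. \<phi> x \<le> 0) \<longrightarrow>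
        (SUP x\<in>{a<..}. \<phi> x) = (SUP x\<in>{b<..}. \<phi> x)) \<and>
     ((\<forall>x\<in>{a..<b}. D_right \<alpha> \<phi> x \<ge> 0) \<longrightarrow> (\<forall>x\<in>{b..}. \<phi> x \<ge> 0) \<longrightarrow>
        (INF x\<in>{a<..}. \<phi> x) = (INF x\<in>{b<..}. \<phi> x)) \<and>
     ((\<forall>x\<in>{a..<b}. D_right \<alpha> \<phi> x \<ge> D_right \<alpha> \<psi> x) \<longrightarrow> (\<forall>x\<in>{b..}. \<phi> x \<ge> \<psi> x) \<longrightarrow>
        (\<forall>x\<in>{a..}. \<phi> x \<ge> \<psi> x)) \<and>
     (\<forall>(f :: real \<Rightarrow> real) (g :: real \<Rightarrow> real) u v.
        dirichlet_solution \<alpha> a b f g u \<longrightarrow> dirichlet_solution \<alpha> a b f g v \<longrightarrow>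
        (\<forall>x\<in>{a..}. u x = v x))"
proof -
  note comparison = D_right_comparison[OF assms(1,2)]
  have nonneg: "\<forall>x\<in>{a..}. \<phi> x \<ge> 0"
    if "\<forall>x\<in>{a..<b}. D_right \<alpha> \<phi> x \<ge> 0" "\<forall>x\<in>{b..}. \<phi> x \<ge> 0"
    using comparison[OF assms(4) schwartz_0, of a b] that by (auto simp: D_right_0)
  have nonpos: "\<forall>x\<in>{a..}. \<phi> x \<le> 0"
    if "\<forall>x\<in>{a..<b}. D_right \<alpha> \<phi> x \<le> 0" "\<forall>x\<in>{b..}. \<phi> x \<le> 0"
    using comparison[OF schwartz_0 assms(4), of a b] that by (auto simp: D_right_0)
  note lim = schwartz_tendsto_0[OF assms(4)]
  show ?thesis
  proof (intro conjI allI impI)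
    fix f :: "real \<Rightarrow> real"
    assume "\<forall>x\<in>{a..<b}. D_right \<alpha> \<phi> x = f x" "\<forall>x\<in>{b..}. \<phi> x = 0" "\<forall>x\<in>{a..<b}. f x \<ge> 0"
    then show "\<forall>x\<in>{a..}. \<phi> x \<ge> 0"
      by (intro nonneg) auto
  next
    assume "\<forall>x\<in>{a..<b}. D_right \<alpha> \<phi> x \<le> 0" "\<forall>x\<in>{b..}. \<phi> x \<le> 0"
    from nonpos[OF this] show "(SUP x\<in>{a<..}. \<phi> x) = (SUP x\<in>{b<..}. \<phi> x)"
      \<comment> \<open>Since a < b, the sign on [a, \<infinity>) also holds on (b, \<infinity>), so
        both suprema are 0.\<close>
      using assms(3) by (simp add: cSUP_eq_0_if_tendsto_0[OF lim])
  next
    assume "\<forall>x\<in>{a..<b}. D_right \<alpha> \<phi> x \<ge> 0" "\<forall>x\<in>{b..}. \<phi> x \<ge> 0"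
    from nonneg[OF this] show "(INF x\<in>{a<..}. \<phi> x) = (INF x\<in>{b<..}. \<phi> x)"
      using assms(3) by (simp add: cINF_eq_0_if_tendsto_0[OF lim])
  next
    assume "\<forall>x\<in>{a..<b}. D_right \<alpha> \<phi> x \<ge> D_right \<alpha> \<psi> x" "\<forall>x\<in>{b..}. \<phi> x \<ge> \<psi> x"
    then show "\<forall>x\<in>{a..}. \<phi> x \<ge> \<psi> x"
      using comparison[OF assms(4,5), of a b] by auto
  next
    \<comment> \<open>Equal data satisfy the comparison hypotheses in both directions; exchanging u
      and v then gives equality.\<close>
    have le: "v x \<le> u x"
      if u: "dirichlet_solution \<alpha> a b f g u" and v: "dirichlet_solution \<alpha> a b f g v" and "a \<le> x"
      for f g u v :: "real \<Rightarrow> real" and x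
    proof (rule comparison[OF _ _ _ _ \<open>a \<le> x\<close>])
      show "schwartz u" "schwartz v"
        using u v by (simp_all add: dirichlet_solution_def)
      show "D_right \<alpha> v y \<le> D_right \<alpha> u y" if "y \<in> {a..<b}" for y
        using u v that by (simp add: dirichlet_solution_def)
      show "v y \<le> u y" if "b \<le> y" for y
        using u v that by (simp add: dirichlet_solution_def)
    qed
    fix f g u v :: "real \<Rightarrow> real"
    assume "dirichlet_solution \<alpha> a b f g u" "dirichlet_solution \<alpha> a b f g v"
    then show "\<forall>x\<in>{a..}. u x = v x"
      using le by (auto intro!: antisym)
  qed
qed

end
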